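(* Let $X$ be a real normed space and let $f:X\to\mathbb{R}$ be a real-valued function. (i) The function $f$ is upper semicontinuous and Lipschitz bounded from above on $X$ if and only if the family $\Sigma^+_{Lip}(f)$ is nonempty and $$f(x)=\inf_{g\in\Sigma^+_{Lip}(f)} g(x)\quad\text{for all } x\in X.$$ (ii) The function $f$ is lower semicontinuous and Lipschitz bounded from below on $X$ if and only if the family $\Sigma^-_{Lip}(f)$ is nonempty and $$f(x)=\sup_{h\in\Sigma^-_{Lip}(f)} h(x)\quad\text{for all } x\in X.$$
   Context: $\overline{\mathbb{R}}=\mathbb{R}\cup\{\pm\infty\}$. A function $g:X\to\overline{\mathbb{R}}$ is convex if $g(x)>-\infty$ for all $x\in X$ and its epigraph $\{(x,\alpha)\in X\times\mathbb{R}: g(x)\le\alpha\}$ is a nonempty convex subset of $X\times\mathbb{R}$; $h$ is concave if $-h$ is convex. A convex majorant of $f$ is a convex function $g:X\to\overline{\mathbb{R}}$ with $f(x)\le g(x)$ for all $x\in X$. A minimal convex majorant of $f$ is a convex majorant $g$ of $f$ that is minimal for the pointwise ordering, i.e. there is no convex majorant $\phi\ne g$ of $f$ with $\phi(x)\le g(x)$ for all $x\in X$. Symmetrically, a concave minorant of $f$ is a concave function $h:X\to\overline{\mathbb{R}}$ with $h(x)\le f(x)$ for all $x$, and a maximal concave minorant is one that is maximal for the pointwise ordering among all concave minorants of $f$. $\Sigma^+_{Lip}(f)$ is the set of all minimal convex majorants of $f$ that are (real-valued and) Lipschitz continuous on the whole of $X$; $\Sigma^-_{Lip}(f)$ is the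 set of all maximal concave minorants of $f$ that are (real-valued and) Lipschitz continuous on the whole of $X$ (the Lipschitz constant may depend on the function). $f$ is Lipschitz bounded from above on $X$ if there is a real-valued function $\psi:X\to\mathbb{R}$, Lipschitz continuous on $X$, with $f(x)\le\psi(x)$ for all $x\in X$; $f$ is Lipschitz bounded from below if $-f$ is Lipschitz bounded from above. *)

theory Defs
  imports "HOL-Analysis.Analysis"
begin

definition ereal_epigraph :: "('a \<Rightarrow> ereal) \<Rightarrow> ('a \<times> real) set" where
  "ereal_epigraph g = {(x, \<alpha>). g x \<le> ereal \<alpha>}"

text \<open>Convex functions are proper: they omit the value \<open>-\<infinity>\<close>, and nonemptiness of the epigraph
  excludes the constant \<open>\<infinity>\<close>.\<close>

definition ereal_convex :: "('a::real_normed_vector \<Rightarrow> ereal) \<Rightarrow> bool" where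
  "ereal_convex g \<longleftrightarrow>
     (\<forall>x. g x > -\<infinity>) \<and> ereal_epigraph g \<noteq> {} \<and> convex (ereal_epigraph g)"

definition ereal_concave :: "('a::real_normed_vector \<Rightarrow> ereal) \<Rightarrow> bool" where
  "ereal_concave h \<longleftrightarrow> ereal_convex (\<lambda>x. - h x)"

definition convex_majorant ::
    "('a::real_normed_vector \<Rightarrow> real) \<Rightarrow> ('a \<Rightarrow> ereal) \<Rightarrow> bool" where
  "convex_majorant f g \<longleftrightarrow> ereal_convex g \<and> (\<forall>x. ereal (f x) \<le> g x)"

definition minimal_convex_majorant ::
    "('a::real_normed_vector \<Rightarrow> real) \<Rightarrow> ('a \<Rightarrow> ereal) \<Rightarrow> bool" where
  "minimal_convex_majorant f g \<longleftrightarrow> convex_majorant f g \<and>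
     \<not> (\<exists>\<phi>. convex_majorant f \<phi> \<and> \<phi> \<noteq> g \<and> (\<forall>x. \<phi> x \<le> g x))"

definition concave_minorant ::
    "('a::real_normed_vector \<Rightarrow> real) \<Rightarrow> ('a \<Rightarrow> ereal) \<Rightarrow> bool" where
  "concave_minorant f h \<longleftrightarrow> ereal_concave h \<and> (\<forall>x. h x \<le> ereal (f x))"

definition maximal_concave_minorant ::
    "('a::real_normed_vector \<Rightarrow> real) \<Rightarrow> ('a \<Rightarrow> ereal) \<Rightarrow> bool" where
  "maximal_concave_minorant f h \<longleftrightarrow> concave_minorant f h \<and>
     \<not> (\<exists>\<phi>. concave_minorant f \<phi> \<and> \<phi> \<noteq> h \<and> (\<forall>x. h x \<le> \<phi> x))"

definition lipschitz_real :: "('a::metric_space \<Rightarrow> real) \<Rightarrow> bool" where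
  "lipschitz_real \<psi> \<longleftrightarrow> (\<exists>L. L-lipschitz_on UNIV \<psi>)"

text \<open>Lipschitz continuity of an extended-real-valued function includes finiteness everywhere.\<close>

definition lipschitz_ereal :: "('a::metric_space \<Rightarrow> ereal) \<Rightarrow> bool" where
  "lipschitz_ereal g \<longleftrightarrow> (\<exists>\<psi>. lipschitz_real \<psi> \<and> g = (\<lambda>x. ereal (\<psi> x)))"

definition Sigma_plus_Lip ::
    "('a::real_normed_vector \<Rightarrow> real) \<Rightarrow> ('a \<Rightarrow> ereal) set" where
  "Sigma_plus_Lip f = {g. minimal_convex_majorant f g \<and> lipschitz_ereal g}"

definition Sigma_minus_Lip ::
    "('a::real_normed_vector \<Rightarrow> real) \<Rightarrow> ('a \<Rightarrow> ereal) set" where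
  "Sigma_minus_Lip f = {h. maximal_concave_minorant f h \<and> lipschitz_ereal h}"

definition lipschitz_bounded_above :: "('a::metric_space \<Rightarrow> real) \<Rightarrow> bool" where
  "lipschitz_bounded_above f \<longleftrightarrow> (\<exists>\<psi>. lipschitz_real \<psi> \<and> (\<forall>x. f x \<le> \<psi> x))"

definition lipschitz_bounded_below :: "('a::metric_space \<Rightarrow> real) \<Rightarrow> bool" where
  "lipschitz_bounded_below f \<longleftrightarrow> lipschitz_bounded_above (\<lambda>x. - f x)"

definition upper_semicontinuous :: "('a::topological_space \<Rightarrow> real) \<Rightarrow> bool" where
  "upper_semicontinuous f \<longleftrightarrow> (\<forall>x. \<forall>c > f x. \<forall>\<^sub>F y in nhds x. f y < c)"

definition lower_semicontinuous :: "('a::topological_space \<Rightarrow> real) \<Rightarrow> bool" where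
  "lower_semicontinuous f \<longleftrightarrow> (\<forall>x. \<forall>c < f x. \<forall>\<^sub>F y in nhds x. c < f y)"

end

theory Submission
  imports Defs
begin

text \<open>A convex function below a \<open>K\<close>-Lipschitz function is itself \<open>K\<close>-Lipschitz, because its slope
  along a ray is at most its asymptotic growth rate.  Hence Zorn's lemma puts below every convex
  Lipschitz majorant a minimal convex majorant that is again Lipschitz.  If \<open>f\<close> is upper
  semicontinuous at \<open>x\<close> and Lipschitz bounded from above, then the cone
  \<open>y \<mapsto> c + K * norm (y - x)\<close> majorizes \<open>f\<close> for every \<open>c > f x\<close> and some \<open>K\<close>, and so the infimum of
  these minimal majorants at \<open>x\<close> is \<open>f x\<close>.  The second part is the first one applied to \<open>- f\<close>.\<close>

section \<open>Real-valued functions as extended-real convex majorants\<close>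

lemma ereal_convex_ereal_iff:
  "ereal_convex (\<lambda>x. ereal (g x)) \<longleftrightarrow> convex_on UNIV g"
proof -
  have "ereal_epigraph (\<lambda>x. ereal (g x)) = epigraph UNIV g"
    by (auto simp: ereal_epigraph_def epigraph_def)
  \<comment> \<open>This point witnesses the nonemptiness of the epigraph that
    \<open>ereal_convex\<close> demands.\<close>
  moreover have "(0, g 0) \<in> epigraph UNIV g"
    by (simp add: epigraph_def)
  ultimately show ?thesis
    by (auto simp: ereal_convex_def convex_epigraph)
qed

lemma convex_majorant_ereal_iff:
  "convex_majorant f (\<lambda>x. ereal (g x)) \<longleftrightarrow> convex_on UNIV g \<and> f \<le> g"
  by (auto simp: convex_majorant_def ereal_convex_ereal_iff le_fun_def)

text \<open>Being squeezed between two real functions forces finite values. Hence minimality, which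
  quantifies over extended-real competitors, can be checked among real functions.\<close>

lemma convex_majorant_le_ereal_real:
  assumes "convex_majorant f \<phi>" and "\<And>x. \<phi> x \<le> ereal (g x)"
  obtains h where "\<phi> = (\<lambda>x. ereal (h x))"
proof
  show "\<phi> = (\<lambda>x. ereal (real_of_ereal (\<phi> x)))"
  proof
    fix x
    have "ereal (f x) \<le> \<phi> x" "\<phi> x \<le> ereal (g x)"
      using assms by (auto simp: convex_majorant_def)
    then show "\<phi> x = ereal (real_of_ereal (\<phi> x))"
      by (cases "\<phi> x") auto
  qed
qed

section \<open>Lipschitz constants pass down to convex functions\<close>

text \<open>By convexity, a rise from \<open>x\<close> to \<open>y\<close> steeper than
  \<open>K\<close> persists along the whole ray from \<open>x\<close> through \<open>y\<close>,
  where \<psi> grows at rate at most \<open>K\<close>. Far enough out, \<open>g\<close> would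
  overtake \<psi>.\<close>

lemma convex_on_lipschitz_of_le:
  fixes g :: "'a::real_normed_vector \<Rightarrow> real"
  assumes cvx: "convex_on UNIV g" and le: "g \<le> \<psi>" and lip: "K-lipschitz_on UNIV \<psi>"
  shows "K-lipschitz_on UNIV g"
proof -
  have slope: "g y - g x \<le> K * norm (y - x)" for x y
  proof (rule ccontr)
    define d where "d = g y - g x - K * norm (y - x)"
    define C where "C = \<psi> x - g x"
    assume "\<not> g y - g x \<le> K * norm (y - x)"
    then have "d > 0" by (simp add: d_def)
    have "C \<ge> 0" using le by (simp add: C_def le_fun_def)
    \<comment> \<open>Comparing \<open>g\<close> with \<psi> at \<open>z\<close> will give
      \<open>t * d \<le> C\<close>. This choice makes \<open>t * d = C + d\<close>, a contradiction,
      and \<open>t \<ge> 1\<close> puts \<open>y\<close> on the segment from \<open>x\<close> to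
      \<open>z\<close> with weight \<open>1 / t\<close>.\<close>
    define t where "t = C / d + 1"
    have "t \<ge> 1" using \<open>d > 0\<close> \<open>C \<ge> 0\<close> by (simp add: t_def)
    define z where "z = x + t *\<^sub>R (y - x)"
    have "(1 - 1 / t) *\<^sub>R x + (1 / t) *\<^sub>R z = y"
      using \<open>t \<ge> 1\<close> by (simp add: z_def algebra_simps)
    then have "g y \<le> (1 - 1 / t) * g x + (1 / t) * g z"
      using convex_onD[OF cvx, of "1 / t" x z] \<open>t \<ge> 1\<close> by simp
    then have "t * g y \<le> t * ((1 - 1 / t) * g x + (1 / t) * g z)"
      using \<open>t \<ge> 1\<close> by (intro mult_left_mono) auto
    also have "\<dots> = (t - 1) * g x + g z"
      using \<open>t \<ge> 1\<close> by (simp add: field_simps)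
    finally have "t * (g y - g x) \<le> g z - g x" by (simp add: algebra_simps)
    also have "g z \<le> \<psi> z" using le by (simp add: le_fun_def)
    also have "\<psi> z \<le> \<psi> x + K * (t * norm (y - x))"
      using lipschitz_onD[OF lip, of z x] \<open>t \<ge> 1\<close> by (simp add: z_def dist_norm)
    finally have "t * d \<le> C" by (simp add: d_def C_def algebra_simps)
    moreover have "t * d = C + d" using \<open>d > 0\<close> by (simp add: t_def field_simps)
    ultimately show False using \<open>d > 0\<close> by simp
  qed
  show ?thesis
  proof (rule lipschitz_onI)
    show "0 \<le> K" using lip by (rule lipschitz_on_nonneg)
    show "dist (g x) (g y) \<le> K * dist x y" for x y
      using slope[of x y] slope[of y x] by (simp add: dist_norm norm_minus_commute abs_if)
  qed
qed

section \<open>Minimal convex majorants by Zorn's lemma\<close>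

text \<open>Infima of convex functions are not convex in general. In a chain, however, of two
  functions nearly attaining the infimum at \<open>x\<close> and at \<open>y\<close> respectively,
  the smaller one does so at both points, and its convexity inequality passes to the limit.\<close>

lemma convex_on_INF_chain:
  fixes C :: "('a::real_vector \<Rightarrow> real) set"
  assumes "C \<noteq> {}" and cvx: "\<And>g. g \<in> C \<Longrightarrow> convex_on UNIV g"
    and chain: "\<And>g h. g \<in> C \<Longrightarrow> h \<in> C \<Longrightarrow> g \<le> h \<or> h \<le> g"
    and bdd: "\<And>x. bdd_below ((\<lambda>g. g x) ` C)"
  shows "convex_on UNIV (\<lambda>x. INF g\<in>C. g x)"
proof (rule convex_onI)
  fix t :: real and x y :: 'a
  assume t: "0 < t" "t < 1"
  let ?m = "\<lambda>x. INF g\<in>C. g x"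
  let ?z = "(1 - t) *\<^sub>R x + t *\<^sub>R y"
  show "?m ?z \<le> (1 - t) * ?m x + t * ?m y"
  proof (rule field_le_epsilon)
    fix e :: real
    assume "e > 0"
    obtain g where g: "g \<in> C" "g x < ?m x + e"
      using \<open>e > 0\<close> \<open>C \<noteq> {}\<close> cINF_less_iff[OF _ bdd, of x "?m x + e"] by auto
    obtain h where h: "h \<in> C" "h y < ?m y + e"
      using \<open>e > 0\<close> \<open>C \<noteq> {}\<close> cINF_less_iff[OF _ bdd, of y "?m y + e"] by auto
    \<comment> \<open>\<open>k\<close> is the smaller of \<open>g\<close> and
      \<open>h\<close>.\<close>
    obtain k where k: "k \<in> C" "k x < ?m x + e" "k y < ?m y + e"
      using chain[OF g(1) h(1)] g h by (meson le_fun_def order_le_less_trans)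
    have "?m ?z \<le> k ?z" using k(1) bdd by (intro cINF_lower)
    also have "\<dots> \<le> (1 - t) * k x + t * k y"
      using convex_onD[OF cvx[OF k(1)], of t x y] t by simp
    also have "\<dots> \<le> (1 - t) * (?m x + e) + t * (?m y + e)"
      using k t by (intro add_mono mult_left_mono) auto
    finally show "?m ?z \<le> (1 - t) * ?m x + t * ?m y + e"
      by (simp add: algebra_simps)
  qed
qed simp

text \<open>Zorn's lemma runs over the real convex functions between \<open>f\<close> and \<psi>. A
  nonempty chain is bounded by its pointwise infimum, which is finite because \<open>f\<close> lies
  below the chain.\<close>

lemma ex_minimal_convex_majorant_le:
  fixes f \<psi> :: "'a::real_normed_vector \<Rightarrow> real"
  assumes "convex_on UNIV \<psi>" and "f \<le> \<psi>"
  obtains g where "minimal_convex_majorant f (\<lambda>x. ereal (g x))" "convex_on UNIV g" "g \<le> \<psi>"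
proof -
  define A where "A = {g. convex_on UNIV g \<and> f \<le> g \<and> g \<le> \<psi>}"
  have "\<exists>m\<in>A. \<forall>a\<in>A. a \<le> m \<longrightarrow> a = m"
  proof (rule predicate_Zorn)
    \<comment> \<open>The order is reversed, so that the maximal element from Zorn's lemma is a
      minimal function.\<close>
    show "partial_order_on A (relation_of (\<lambda>g h. h \<le> g) A)"
      by (rule partial_order_on_relation_ofI) auto
  next
    fix C
    assume C: "C \<in> Chains (relation_of (\<lambda>g h. h \<le> g) A)"
    have sub: "C \<subseteq> A" and chain: "\<And>g h. g \<in> C \<Longrightarrow> h \<in> C \<Longrightarrow> g \<le> h \<or> h \<le> g"
      using C by (auto simp: Chains_def relation_of_def)
    show "\<exists>u\<in>A. \<forall>a\<in>C. u \<le> a"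
    proof (cases "C = {}")
      \<comment> \<open>The infimum formula is of no use for the empty chain; \<psi> itself serves
        as the bound.\<close>
      case True
      then show ?thesis using assms by (auto simp: A_def)
    next
      case False
      let ?m = "\<lambda>x. INF g\<in>C. g x"
      have bdd: "bdd_below ((\<lambda>g. g x) ` C)" for x
        using sub by (intro bdd_belowI2[of _ "f x"]) (auto simp: A_def le_fun_def)
      have lower: "?m \<le> a" if "a \<in> C" for a
        using that bdd by (auto intro!: le_funI cINF_lower)
      have "convex_on UNIV ?m"
        using False sub chain bdd by (intro convex_on_INF_chain) (auto simp: A_def)
      moreover have "f \<le> ?m"
        using False sub by (auto intro!: le_funI cINF_greatest simp: A_def le_fun_def)
      moreover have "?m \<le> \<psi>"
      proof -
        obtain g where "g \<in> C" using False by blast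
        then have "?m \<le> g" "g \<le> \<psi>" using lower sub by (auto simp: A_def)
        then show ?thesis by (rule order_trans)
      qed
      ultimately show ?thesis using lower by (auto simp: A_def)
    qed
  qed
  then obtain g where "g \<in> A" and min: "\<And>h. h \<in> A \<Longrightarrow> h \<le> g \<Longrightarrow> h = g" by blast
  then have g: "convex_on UNIV g" "f \<le> g" "g \<le> \<psi>" by (auto simp: A_def)
  \<comment> \<open>Any extended-real competitor below \<open>g\<close> is real-valued and belongs
    to \<open>A\<close>, so minimality within \<open>A\<close> suffices.\<close>
  have "\<phi> = (\<lambda>x. ereal (g x))"
    if \<phi>: "convex_majorant f \<phi>" "\<And>x. \<phi> x \<le> ereal (g x)" for \<phi>
  proof -
    obtain h where h: "\<phi> = (\<lambda>x. ereal (h x))"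
      using convex_majorant_le_ereal_real[OF \<phi>] .
    then have "h \<le> g" using \<phi>(2) by (simp add: le_fun_def)
    moreover have "h \<in> A"
      using \<phi>(1) \<open>h \<le> g\<close> \<open>g \<le> \<psi>\<close> by (auto simp: A_def h convex_majorant_ereal_iff)
    ultimately show ?thesis using min h by blast
  qed
  then have "minimal_convex_majorant f (\<lambda>x. ereal (g x))"
    using g by (auto simp: minimal_convex_majorant_def convex_majorant_ereal_iff)
  then show thesis using that g by blast
qed

section \<open>Cones above an upper semicontinuous function\<close>

text \<open>Near \<open>x\<close>, semicontinuity keeps \<open>f\<close> below the apex value
  \<open>c\<close>. Away from \<open>x\<close>, the Lipschitz bound \<psi> takes over, and a steep
  enough cone lies above it.\<close>

lemma ex_cone_majorant:
  fixes f :: "'a::real_normed_vector \<Rightarrow> real"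
  assumes usc: "upper_semicontinuous f" and bdd: "lipschitz_bounded_above f" and "f x < c"
  obtains K where "K \<ge> 0" "\<And>y. f y \<le> c + K * norm (y - x)"
proof -
  obtain \<psi> L where L: "L-lipschitz_on UNIV \<psi>" and f_le: "\<And>y. f y \<le> \<psi> y"
    using bdd by (auto simp: lipschitz_bounded_above_def lipschitz_real_def)
  have "L \<ge> 0" using L by (rule lipschitz_on_nonneg)
  obtain d where "d > 0" and d: "\<And>y. dist y x < d \<Longrightarrow> f y < c"
    using usc \<open>f x < c\<close> unfolding upper_semicontinuous_def eventually_nhds_metric by metis
  define M where "M = max 0 (\<psi> x - c)"
  have "M \<ge> 0" "\<psi> x \<le> c + M" by (auto simp: M_def)
  \<comment> \<open>\<open>L\<close> matches the growth of \<psi>. The extra slope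
    \<open>M / d\<close> absorbs the excess \<open>M\<close> of \<psi> over \<open>c\<close> at
    \<open>x\<close> once the distance from \<open>x\<close> is at least \<open>d\<close>.\<close>
  define K where "K = L + M / d"
  have "K \<ge> 0" using \<open>L \<ge> 0\<close> \<open>M \<ge> 0\<close> \<open>d > 0\<close> by (simp add: K_def)
  have "f y \<le> c + K * norm (y - x)" for y
  proof (cases "dist y x < d")
    case True
    then have "f y < c" by (rule d)
    moreover have "0 \<le> K * norm (y - x)" using \<open>K \<ge> 0\<close> by simp
    ultimately show ?thesis by linarith
  next
    case False
    then have "M * 1 \<le> M * (norm (y - x) / d)"
      using \<open>M \<ge> 0\<close> \<open>d > 0\<close> by (intro mult_left_mono) (auto simp: dist_norm)
    moreover have "f y \<le> \<psi> x + L * norm (y - x)"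
      using f_le[of y] lipschitz_onD[OF L, of y x] by (simp add: dist_norm)
    ultimately show ?thesis using \<open>\<psi> x \<le> c + M\<close> by (simp add: K_def algebra_simps)
  qed
  then show thesis using that \<open>K \<ge> 0\<close> by blast
qed

lemma convex_on_norm_cone:
  fixes x :: "'a::real_normed_vector"
  assumes "K \<ge> 0"
  shows "convex_on UNIV (\<lambda>y. c + K * norm (y - x))"
  using convex_on_add[OF convex_on_const[THEN iffD2, OF convex_UNIV, of c]
      convex_on_cmul[OF assms convex_on_dist[OF convex_UNIV, of x]]]
  by (simp add: dist_norm norm_minus_commute)

lemma lipschitz_on_norm_cone:
  fixes x :: "'a::real_normed_vector"
  assumes "K \<ge> 0"
  shows "K-lipschitz_on UNIV (\<lambda>y. c + K * norm (y - x))"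
proof (rule lipschitz_onI)
  fix y z
  have "\<bar>norm (y - x) - norm (z - x)\<bar> \<le> norm (y - z)"
    using norm_triangle_ineq3[of "y - x" "z - x"] by simp
  then have "K * \<bar>norm (y - x) - norm (z - x)\<bar> \<le> K * norm (y - z)"
    using assms by (rule mult_left_mono)
  then show "dist (c + K * norm (y - x)) (c + K * norm (z - x)) \<le> K * dist y z"
    using assms by (simp add: dist_norm abs_mult flip: right_diff_distrib)
qed (fact assms)

section \<open>The upper envelope formula\<close>

text \<open>The cone equals \<open>c\<close> at its apex \<open>x\<close>, so a minimal majorant
  below it is at most \<open>c\<close> there and inherits the Lipschitz constant
  \<open>K\<close>.\<close>

lemma ex_Sigma_plus_Lip_le:
  fixes f :: "'a::real_normed_vector \<Rightarrow> real"
  assumes "upper_semicontinuous f" and "lipschitz_bounded_above f" and "f x < c"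
  shows "\<exists>g\<in>Sigma_plus_Lip f. g x \<le> ereal c"
proof -
  obtain K where K: "K \<ge> 0" "\<And>y. f y \<le> c + K * norm (y - x)"
    using ex_cone_majorant[OF assms] by blast
  let ?\<psi> = "\<lambda>y. c + K * norm (y - x)"
  obtain g where g: "minimal_convex_majorant f (\<lambda>x. ereal (g x))" "convex_on UNIV g" "g \<le> ?\<psi>"
    using ex_minimal_convex_majorant_le[OF convex_on_norm_cone[OF K(1)], of f c x] K(2)
    by (auto simp: le_fun_def)
  have "K-lipschitz_on UNIV g"
    using convex_on_lipschitz_of_le[OF g(2,3) lipschitz_on_norm_cone[OF K(1)]] .
  then have "(\<lambda>x. ereal (g x)) \<in> Sigma_plus_Lip f"
    using g(1) by (auto simp: Sigma_plus_Lip_def lipschitz_ereal_def lipschitz_real_def)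
  moreover have "g x \<le> c" using g(3) by (auto simp: le_fun_def dest: spec[of _ x])
  ultimately show ?thesis by (intro bexI[of _ "\<lambda>x. ereal (g x)"]) simp_all
qed

lemma Sigma_plus_LipE:
  assumes "g \<in> Sigma_plus_Lip f"
  obtains \<psi> where "g = (\<lambda>x. ereal (\<psi> x))" "lipschitz_real \<psi>" "\<And>x. f x \<le> \<psi> x"
  using assms
  by (auto simp: Sigma_plus_Lip_def lipschitz_ereal_def minimal_convex_majorant_def
      convex_majorant_def)

text \<open>For the converse, any member of the family is a Lipschitz bound, and an infimum of
  continuous functions is upper semicontinuous.\<close>

lemma upper_semicontinuous_lipschitz_bounded_above_iff:
  fixes f :: "'a::real_normed_vector \<Rightarrow> real"
  shows "upper_semicontinuous f \<and> lipschitz_bounded_above f \<longleftrightarrow>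
    Sigma_plus_Lip f \<noteq> {} \<and> (\<forall>x. ereal (f x) = (INF g\<in>Sigma_plus_Lip f. g x))"
proof safe
  assume f: "upper_semicontinuous f" "lipschitz_bounded_above f"
  note ex = ex_Sigma_plus_Lip_le[OF f]
  show False if "Sigma_plus_Lip f = {}"
    using ex[of 0 "f 0 + 1"] that by simp
  fix x
  show "ereal (f x) = (INF g\<in>Sigma_plus_Lip f. g x)"
  proof (rule antisym)
    show "ereal (f x) \<le> (INF g\<in>Sigma_plus_Lip f. g x)"
      by (auto intro!: INF_greatest elim!: Sigma_plus_LipE)
    show "(INF g\<in>Sigma_plus_Lip f. g x) \<le> ereal (f x)"
    proof (rule ereal_le_epsilon2)
      fix e :: real
      assume "e > 0"
      then show "(INF g\<in>Sigma_plus_Lip f. g x) \<le> ereal (f x) + ereal e"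
        using ex[of x "f x + e"] by (auto intro: INF_lower2)
    qed
  qed
next
  fix g
  assume "g \<in> Sigma_plus_Lip f"
  then show "lipschitz_bounded_above f"
    by (auto simp: lipschitz_bounded_above_def elim!: Sigma_plus_LipE)
next
  assume INF: "\<forall>x. ereal (f x) = (INF g\<in>Sigma_plus_Lip f. g x)"
  show "upper_semicontinuous f"
    unfolding upper_semicontinuous_def
  proof (intro allI impI)
    fix x c
    assume "f x < c"
    then have "(INF g\<in>Sigma_plus_Lip f. g x) < ereal c"
      by (simp flip: INF[rule_format])
    then obtain g where g: "g \<in> Sigma_plus_Lip f" "g x < ereal c"
      by (auto simp: INF_less_iff)
    then obtain \<psi> where \<psi>: "g = (\<lambda>x. ereal (\<psi> x))" "lipschitz_real \<psi>" "\<And>x. f x \<le> \<psi> x"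
      using Sigma_plus_LipE[OF g(1)] by blast
    have "isCont \<psi> x"
      using \<psi>(2) lipschitz_on_continuous_on[of _ UNIV \<psi>]
      by (auto simp: lipschitz_real_def continuous_on_eq_continuous_at)
    \<comment> \<open>A single member below \<open>c\<close> at \<open>x\<close> stays below
      \<open>c\<close> nearby by continuity, and it dominates \<open>f\<close>.\<close>
    then have "\<forall>\<^sub>F y in nhds x. \<psi> y < c"
      using g(2) \<psi>(1) by (auto simp: isCont_def tendsto_at_iff_tendsto_nhds intro: order_tendstoD)
    then show "\<forall>\<^sub>F y in nhds x. f y < c"
      by eventually_elim (use \<psi>(3) in \<open>meson order_le_less_trans\<close>)
  qed
qed

section \<open>Duality under negation\<close>

lemma concave_minorant_uminus_iff:
  "concave_minorant f h \<longleftrightarrow> convex_majorant (\<lambda>x. - f x) (\<lambda>x. - h x)"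
  by (simp add: concave_minorant_def convex_majorant_def ereal_concave_def
      flip: uminus_ereal.simps)

text \<open>Negation is an order-reversing involution, so it matches the competitors on the two
  sides.\<close>

lemma maximal_concave_minorant_uminus_iff:
  "maximal_concave_minorant f h \<longleftrightarrow> minimal_convex_majorant (\<lambda>x. - f x) (\<lambda>x. - h x)"
proof -
  have "(\<exists>\<phi>. concave_minorant f \<phi> \<and> \<phi> \<noteq> h \<and> (\<forall>x. h x \<le> \<phi> x)) \<longleftrightarrow>
    (\<exists>\<phi>. convex_majorant (\<lambda>x. - f x) \<phi> \<and> \<phi> \<noteq> (\<lambda>x. - h x) \<and> (\<forall>x. \<phi> x \<le> - h x))"
    (is "?L \<longleftrightarrow> ?R")
  proof
    assume ?L
    then obtain \<phi> where "concave_minorant f \<phi>" "\<phi> \<noteq> h" "\<forall>x. h x \<le> \<phi> x" by blast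
    then show ?R
      by (intro exI[of _ "\<lambda>x. - \<phi> x"]) (auto simp: concave_minorant_uminus_iff fun_eq_iff)
  next
    assume ?R
    then obtain \<phi> where \<phi>: "convex_majorant (\<lambda>x. - f x) \<phi>" "\<phi> \<noteq> (\<lambda>x. - h x)" "\<forall>x. \<phi> x \<le> - h x"
      by blast
    then have "\<forall>x. h x \<le> - \<phi> x" using ereal_minus_le_minus ereal_uminus_uminus by metis
    with \<phi> show ?L
      by (intro exI[of _ "\<lambda>x. - \<phi> x"])
        (auto simp: concave_minorant_uminus_iff fun_eq_iff ereal_uminus_eq_reorder)
  qed
  then show ?thesis
    by (simp add: maximal_concave_minorant_def minimal_convex_majorant_def
        concave_minorant_uminus_iff)
qed

lemma lipschitz_ereal_uminus:
  fixes g :: "'a::metric_space \<Rightarrow> ereal"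
  assumes "lipschitz_ereal g"
  shows "lipschitz_ereal (\<lambda>x. - g x)"
proof -
  obtain \<psi> L where "L-lipschitz_on UNIV \<psi>" "g = (\<lambda>x. ereal (\<psi> x))"
    using assms by (auto simp: lipschitz_ereal_def lipschitz_real_def)
  then show ?thesis
    by (auto simp: lipschitz_ereal_def lipschitz_real_def intro!: exI[of _ "\<lambda>x. - \<psi> x"] exI[of _ L])
qed

text \<open>The image form turns a supremum over the left side into a negated infimum over the
  family of \<open>- f\<close>.\<close>

lemma Sigma_minus_Lip_eq_image:
  "Sigma_minus_Lip f = (\<lambda>g x. - g x) ` Sigma_plus_Lip (\<lambda>x. - f x)"
proof (intro equalityI subsetI)
  fix h
  assume "h \<in> Sigma_minus_Lip f"
  then have "(\<lambda>x. - h x) \<in> Sigma_plus_Lip (\<lambda>x. - f x)"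
    by (simp add: Sigma_minus_Lip_def Sigma_plus_Lip_def maximal_concave_minorant_uminus_iff
        lipschitz_ereal_uminus)
  then show "h \<in> (\<lambda>g x. - g x) ` Sigma_plus_Lip (\<lambda>x. - f x)"
    by (rule rev_image_eqI) simp
qed (auto simp: Sigma_minus_Lip_def Sigma_plus_Lip_def maximal_concave_minorant_uminus_iff
    lipschitz_ereal_uminus)

lemma lower_semicontinuous_uminus_iff:
  "lower_semicontinuous f \<longleftrightarrow> upper_semicontinuous (\<lambda>x. - f x)"
  unfolding lower_semicontinuous_def upper_semicontinuous_def
proof (intro iffI allI impI)
  fix x c
  assume "\<forall>x. \<forall>c<f x. \<forall>\<^sub>F y in nhds x. c < f y" and "- f x < c"
  then have "\<forall>\<^sub>F y in nhds x. - c < f y" by simp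
  then show "\<forall>\<^sub>F y in nhds x. - f y < c" by eventually_elim simp
next
  fix x c
  assume "\<forall>x. \<forall>c>- f x. \<forall>\<^sub>F y in nhds x. - f y < c" and "c < f x"
  then have "\<forall>\<^sub>F y in nhds x. - f y < - c" by (metis neg_less_iff_less)
  then show "\<forall>\<^sub>F y in nhds x. c < f y" by eventually_elim simp
qed

theorem theorem4p8:
  fixes f :: "'a::real_normed_vector \<Rightarrow> real"
  shows "(upper_semicontinuous f \<and> lipschitz_bounded_above f \<longleftrightarrow>
           Sigma_plus_Lip f \<noteq> {} \<and> (\<forall>x. ereal (f x) = (INF g\<in>Sigma_plus_Lip f. g x)))
       \<and> (lower_semicontinuous f \<and> lipschitz_bounded_below f \<longleftrightarrow>
           Sigma_minus_Lip f \<noteq> {} \<and> (\<forall>x. ereal (f x) = (SUP h\<in>Sigma_minus_Lip f. h x)))"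
proof -
  let ?S = "Sigma_plus_Lip (\<lambda>x. - f x)"
  have "ereal (f x) = (SUP h\<in>Sigma_minus_Lip f. h x) \<longleftrightarrow> ereal (- f x) = (INF g\<in>?S. g x)" for x
  proof -
    \<comment> \<open>Extended-real negation exchanges suprema and infima unconditionally, so empty
      families need no separate treatment.\<close>
    have "(SUP h\<in>Sigma_minus_Lip f. h x) = - (INF g\<in>?S. g x)"
      by (simp add: Sigma_minus_Lip_eq_image image_image ereal_SUP_uminus_eq)
    then show ?thesis
      by (simp add: ereal_uminus_eq_reorder flip: uminus_ereal.simps(1))
  qed
  then show ?thesis
    using upper_semicontinuous_lipschitz_bounded_above_iff[of f]
      upper_semicontinuous_lipschitz_bounded_above_iff[of "\<lambda>x. - f x"]
    by (simp add: lower_semicontinuous_uminus_iff lipschitz_bounded_below_def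
        Sigma_minus_Lip_eq_image)
qed

end
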